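(* The class of cycles (graphs isomorphic to $C_m$ for some $m\ge3$) has no $2$ adaptive hom algorithm.
   Context: Graphs are finite, simple, undirected, with non-empty vertex set; classes are closed under isomorphism; $\textsc{Graph}$ is the class of all graphs; $C_m$ is the cycle on $m$ vertices. $\hom(F,G)$ is the number of homomorphisms from $F$ to $G$. For $k\ge1$, a $k$ adaptive hom algorithm for a class $\mathcal C$ consists of a graph $F$, a function $N:\bigcup_{i\in[k-1]}\mathbb N^i\to\textsc{Graph}$, and a set $X\subseteq\mathbb N^k$ such that for all graphs $G$: $G\in\mathcal C\iff(n_1,\dots,n_k)\in X$, where $n_1:=\hom(F,G)$ and $n_{j+1}:=\hom(N(n_1,\dots,n_j),G)$ for $j\in[k-1]$. *)

theory Defs
  imports "Graph_Theory.Graph_Theory" "HOL-Library.FuncSet"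
begin

text \<open>A finite simple undirected graph is a \<open>pair_graph\<close>: finite vertex set, symmetric loop-free set
  of ordered pairs, so that an edge \<open>{u, v}\<close> is present as both \<open>(u, v)\<close> and \<open>(v, u)\<close>.\<close>

definition simple_graph :: "'a pair_pre_digraph \<Rightarrow> bool" where
  "simple_graph G \<longleftrightarrow> pair_graph G \<and> pverts G \<noteq> {}"

text \<open>Homomorphisms are extensional functions, so that each one is counted exactly once.\<close>

definition graph_homs :: "'a pair_pre_digraph \<Rightarrow> 'b pair_pre_digraph \<Rightarrow> ('a \<Rightarrow> 'b) set" where
  "graph_homs F G =
     {f \<in> pverts F \<rightarrow>\<^sub>E pverts G. \<forall>u v. (u, v) \<in> parcs F \<longrightarrow> (f u, f v) \<in> parcs G}"

definition hom_count :: "'a pair_pre_digraph \<Rightarrow> 'b pair_pre_digraph \<Rightarrow> nat" where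
  "hom_count F G = card (graph_homs F G)"

text \<open>The list \<open>[n\<^sub>1, \<dots>, n\<^sub>k]\<close> with \<open>n\<^sub>1 = hom(F, G)\<close> and
  \<open>n\<^sub>j\<^sub>+\<^sub>1 = hom(N(n\<^sub>1, \<dots>, n\<^sub>j), G)\<close> for \<open>1 \<le> j < k\<close>.\<close>

fun hom_answers ::
  "'a pair_pre_digraph \<Rightarrow> (nat list \<Rightarrow> 'a pair_pre_digraph) \<Rightarrow> 'b pair_pre_digraph \<Rightarrow> nat \<Rightarrow> nat list"
where
  "hom_answers F N G 0 = []"
| "hom_answers F N G (Suc 0) = [hom_count F G]"
| "hom_answers F N G (Suc (Suc j)) =
     (let ns = hom_answers F N G (Suc j) in ns @ [hom_count (N ns) G])"

text \<open>Every finite graph has an isomorphic copy with vertices in \<open>nat\<close>, so the class of all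
  graphs is represented by the simple graphs over \<open>nat\<close>. Tuples are lists; \<open>N\<close> is constrained
  and used only on lists of length \<open>1, \<dots>, k - 1\<close>.\<close>

definition adaptive_hom_algorithm ::
  "nat \<Rightarrow> nat pair_pre_digraph set \<Rightarrow> nat pair_pre_digraph \<Rightarrow>
    (nat list \<Rightarrow> nat pair_pre_digraph) \<Rightarrow> nat list set \<Rightarrow> bool" where
  "adaptive_hom_algorithm k \<C> F N X \<longleftrightarrow>
     k \<ge> 1 \<and> simple_graph F \<and>
     (\<forall>ns. 1 \<le> length ns \<and> length ns \<le> k - 1 \<longrightarrow> simple_graph (N ns)) \<and>
     X \<subseteq> {ns. length ns = k} \<and>
     (\<forall>G. simple_graph G \<longrightarrow> (G \<in> \<C> \<longleftrightarrow> hom_answers F N G k \<in> X))"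

definition cycle_graph :: "nat \<Rightarrow> nat pair_pre_digraph" where
  "cycle_graph m =
     \<lparr>pverts = {..<m},
      parcs = {(u, v). u < m \<and> v < m \<and> (v = (u + 1) mod m \<or> u = (v + 1) mod m)}\<rparr>"

definition cycle_class :: "nat pair_pre_digraph set" where
  "cycle_class =
     {G. simple_graph G \<and> (\<exists>m\<ge>3. digraph_iso (with_proj (cycle_graph m)) (with_proj G))}"

lemma simple_graph_iff:
  "simple_graph G \<longleftrightarrow>
     finite (pverts G) \<and> pverts G \<noteq> {} \<and> parcs G \<subseteq> pverts G \<times> pverts G \<and>
     sym (parcs G) \<and> irrefl (parcs G)"
proof
  assume "simple_graph G"
  then interpret pair_graph G by (simp add: simple_graph_def)
  show "finite (pverts G) \<and> pverts G \<noteq> {} \<and> parcs G \<subseteq> pverts G \<times> pverts G \<and>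
     sym (parcs G) \<and> irrefl (parcs G)"
    using \<open>simple_graph G\<close> pair_finite_verts in_arcsD1 in_arcsD2 pair_sym_arcs pair_no_loops
    by (fastforce simp: simple_graph_def symmetric_def irrefl_def)
next
  assume *: "finite (pverts G) \<and> pverts G \<noteq> {} \<and> parcs G \<subseteq> pverts G \<times> pverts G \<and>
     sym (parcs G) \<and> irrefl (parcs G)"
  then have "finite (parcs G)" by (meson finite_SigmaI finite_subset)
  with * have "pair_graph G"
    by unfold_locales (auto simp: symmetric_def irrefl_def)
  with * show "simple_graph G" by (simp add: simple_graph_def)
qed

lemma simple_graph_cycle_graph:
  assumes "m \<ge> 3" shows "simple_graph (cycle_graph m)"
  using assms
  by (auto simp: simple_graph_iff cycle_graph_def sym_def irrefl_def mod_Suc lessThan_empty_iff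
    split: if_splits)

lemma digraph_iso_with_proj_iff:
  assumes "simple_graph G" "simple_graph H"
  shows "digraph_iso (with_proj G) (with_proj H) \<longleftrightarrow>
     (\<exists>f. bij_betw f (pverts G) (pverts H) \<and>
       (\<forall>u\<in>pverts G. \<forall>v\<in>pverts G. (u, v) \<in> parcs G \<longleftrightarrow> (f u, f v) \<in> parcs H))"
    (is "?L \<longleftrightarrow> ?R")
proof
  have G: "parcs G \<subseteq> pverts G \<times> pverts G" and H: "parcs H \<subseteq> pverts H \<times> pverts H"
    using assms by (auto simp: simple_graph_iff)
  {
    assume ?L
    then obtain h where h: "pre_digraph.digraph_isomorphism (with_proj G) h"
      and eq: "with_proj H = app_iso h (with_proj G)"
      by (auto simp: digraph_iso_def)
    have v: "pverts H = iso_verts h ` pverts G" and a: "parcs H = iso_arcs h ` parcs G"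
      and t: "iso_tail h = fst" and hd: "iso_head h = snd"
      using eq by (simp_all add: with_proj_def app_iso_def)
    have inj: "inj_on (iso_verts h) (pverts G)"
      and ar: "\<And>e. e \<in> parcs G \<Longrightarrow> iso_arcs h e = (iso_verts h (fst e), iso_verts h (snd e))"
      using h t hd by (auto simp: pre_digraph.digraph_isomorphism_def prod_eq_iff)
    have "(u, v) \<in> parcs G \<longleftrightarrow> (iso_verts h u, iso_verts h v) \<in> parcs H"
      if "u \<in> pverts G" "v \<in> pverts G" for u v
    proof
      assume "(u, v) \<in> parcs G"
      then show "(iso_verts h u, iso_verts h v) \<in> parcs H"
        using ar[of "(u, v)"] a by (metis fst_conv snd_conv imageI)
    next
      assume "(iso_verts h u, iso_verts h v) \<in> parcs H"
      then obtain e where e: "e \<in> parcs G" "iso_arcs h e = (iso_verts h u, iso_verts h v)"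
        using a by auto
      then have "iso_verts h (fst e) = iso_verts h u" "iso_verts h (snd e) = iso_verts h v"
        using ar by auto
      moreover have "fst e \<in> pverts G" "snd e \<in> pverts G" using e G by auto
      ultimately have "fst e = u" "snd e = v" using inj that by (auto dest: inj_onD)
      then show "(u, v) \<in> parcs G" using e by (cases e) auto
    qed
    then show ?R using inj v by (intro exI[of _ "iso_verts h"]) (auto simp: bij_betw_def)
  next
    assume ?R
    then obtain f where f: "bij_betw f (pverts G) (pverts H)"
      and e: "\<And>u v. u \<in> pverts G \<Longrightarrow> v \<in> pverts G \<Longrightarrow>
        (u, v) \<in> parcs G \<longleftrightarrow> (f u, f v) \<in> parcs H" by blast
    define h where "h = \<lparr>iso_verts = f, iso_arcs = map_prod f f,
      iso_head = (snd :: 'b \<times> 'b \<Rightarrow> 'b), iso_tail = fst\<rparr>"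
    interpret pair_graph G using assms by (simp add: simple_graph_def)
    have wf: "wf_digraph (with_proj G)" by unfold_locales
    have inj: "inj_on (map_prod f f) (parcs G)"
      using f G by (auto simp: bij_betw_def intro: inj_on_subset[OF map_prod_inj_on])
    have "parcs H \<subseteq> map_prod f f ` parcs G"
    proof
      fix p assume p: "p \<in> parcs H"
      then obtain u v where "u \<in> pverts G" "v \<in> pverts G" "p = (f u, f v)"
        using H bij_betw_imp_surj_on[OF f] by (cases p) blast
      then show "p \<in> map_prod f f ` parcs G" using e p by force
    qed
    moreover have "map_prod f f ` parcs G \<subseteq> parcs H" using e G by auto
    ultimately have "with_proj H = app_iso h (with_proj G)"
      using f by (auto simp: with_proj_def app_iso_def h_def bij_betw_def)
    moreover have "pre_digraph.digraph_isomorphism (with_proj G) h"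
      using f inj wf by (auto simp: pre_digraph.digraph_isomorphism_def h_def bij_betw_def)
    ultimately show ?L by (auto simp: digraph_iso_def)
  }
qed

end

theory Submission
  imports Defs "HOL-Number_Theory.Cong"
begin

text \<open>The cycle \<open>C\<^sub>k\<^sub>m\<close> and the disjoint union \<open>k C\<^sub>m\<close> are both \<open>k\<close>-fold covers of \<open>C\<^sub>m\<close>, with sheets
  indexed by \<open>\<int>/k\<close>. A homomorphism \<open>F \<rightarrow> k C\<^sub>m\<close> turns into a homomorphism \<open>F \<rightarrow> C\<^sub>k\<^sub>m\<close> by shifting the sheet
  at each vertex of \<open>F\<close>, provided its projection \<open>b : F \<rightarrow> C\<^sub>m\<close> admits a shift \<open>p : F \<rightarrow> \<int>/k\<close> that
  grows by one exactly when \<open>b\<close> passes from \<open>m - 1\<close> to \<open>0\<close>. Such a shift exists in two situations: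
  if \<open>F\<close> has fewer than \<open>m\<close> vertices, since then \<open>b\<close> misses a vertex of \<open>C\<^sub>m\<close> and the cycle can be cut
  there; and if \<open>F\<close> is bipartite, \<open>k = 2\<close> and \<open>m\<close> is odd, where the bipartition of \<open>F\<close> provides it.

  Now let \<open>q\<close> be odd and large. The first query does not distinguish \<open>C\<^sub>6\<^sub>q\<close>, \<open>3 C\<^sub>2\<^sub>q\<close> and \<open>2 C\<^sub>3\<^sub>q\<close>, so
  the second query is the same graph \<open>H\<close> for all three. If \<open>H\<close> is bipartite, it does not distinguish
  \<open>C\<^sub>6\<^sub>q\<close> from \<open>2 C\<^sub>3\<^sub>q\<close>; otherwise it has no homomorphism to the bipartite graphs \<open>C\<^sub>6\<^sub>q\<close> and \<open>3 C\<^sub>2\<^sub>q\<close>.\<close>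

section \<open>Disjoint unions of cycles\<close>

text \<open>Vertex \<open>x\<close> is position \<open>x mod m\<close> in copy
  \<open>x div m\<close>. The vertex set is that of \<open>cycle_graph (k * m)\<close>, so the maps
  into either graph form one function space.\<close>

definition cycle_copies :: "nat \<Rightarrow> nat \<Rightarrow> nat pair_pre_digraph" where
  "cycle_copies k m =
     \<lparr>pverts = {..<k * m},
      parcs = {(x, y). x < k * m \<and> y < k * m \<and> x div m = y div m \<and>
        (y mod m = (x mod m + 1) mod m \<or> x mod m = (y mod m + 1) mod m)}\<rparr>"

lemma simple_graph_cycle_copies:
  assumes "k \<ge> 1" "m \<ge> 3" shows "simple_graph (cycle_copies k m)"
proof -
  have "u \<noteq> Suc u mod m" if "u < m" for u
    using that assms by (cases "Suc u = m") auto
  then have "x mod m \<noteq> Suc (x mod m) mod m" for x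
    using assms by simp
  then have "irrefl (parcs (cycle_copies k m))"
    by (auto simp: cycle_copies_def irrefl_def)
  then show ?thesis
    using assms by (auto simp: simple_graph_iff cycle_copies_def sym_def lessThan_empty_iff)
qed

lemma cycle_graph_in_cycle_class:
  assumes "m \<ge> 3" shows "cycle_graph m \<in> cycle_class"
proof -
  note s = simple_graph_cycle_graph[OF assms]
  have "digraph_iso (with_proj (cycle_graph m)) (with_proj (cycle_graph m))"
    unfolding digraph_iso_with_proj_iff[OF s s] by (intro exI[of _ id]) auto
  then show ?thesis using s assms by (auto simp: cycle_class_def)
qed

text \<open>Walking along a cycle never leaves a copy, so an isomorphism could not reach both
  \<open>0\<close> and \<open>m\<close>, which lie in different copies.\<close>

lemma cycle_copies_notin_cycle_class:
  assumes "k \<ge> 2" "m \<ge> 3" shows "cycle_copies k m \<notin> cycle_class"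
proof
  assume "cycle_copies k m \<in> cycle_class"
  then obtain n where n: "n \<ge> 3"
    and iso: "digraph_iso (with_proj (cycle_graph n)) (with_proj (cycle_copies k m))"
    by (auto simp: cycle_class_def)
  have "simple_graph (cycle_copies k m)" using assms by (intro simple_graph_cycle_copies) auto
  with iso obtain f where f: "bij_betw f {..<n} {..<k * m}"
    and e: "\<And>u v. u < n \<Longrightarrow> v < n \<Longrightarrow>
      (u, v) \<in> parcs (cycle_graph n) \<longleftrightarrow> (f u, f v) \<in> parcs (cycle_copies k m)"
    by (auto simp: digraph_iso_with_proj_iff simple_graph_cycle_graph n)
       (auto simp: cycle_graph_def cycle_copies_def)
  have same: "f x div m = f 0 div m" if "x < n" for x
    using that
  proof (induction x)
    case (Suc x)
    then have "(x, Suc x) \<in> parcs (cycle_graph n)" by (auto simp: cycle_graph_def)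
    with e Suc.prems have "(f x, f (Suc x)) \<in> parcs (cycle_copies k m)" by simp
    with Suc show ?case by (simp add: cycle_copies_def)
  qed simp
  have surj: "f ` {..<n} = {..<k * m}" using f by (simp add: bij_betw_def)
  have "2 * m \<le> k * m" using assms by simp
  then have "0 \<in> f ` {..<n}" "m \<in> f ` {..<n}" unfolding surj using assms by auto
  then obtain a b where "a < n" "f a = 0" "b < n" "f b = m" by auto
  with same[of a] same[of b] show False using assms by simp
qed

section \<open>Shifting sheets\<close>

text \<open>The covering in coordinates: the sheet \<open>x div m\<close> advances only when the
  position wraps to \<open>0\<close>.\<close>

lemma cyclic_successor_iff:
  fixes m k x y :: nat
  assumes "m > 0"
  shows "y = (x + 1) mod (k * m) \<longleftrightarrow>
    y mod m = (x mod m + 1) mod m \<and>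
    y div m = (x div m + (if x mod m + 1 = m then 1 else 0)) mod k"
proof -
  have d: "(x + 1) div m = x div m + (if x mod m + 1 = m then 1 else 0)"
    using assms by (simp add: div_Suc mod_Suc)
  have r: "(x + 1) mod m = (x mod m + 1) mod m" by (simp add: mod_Suc_eq)
  have "(x + 1) mod (k * m) = m * ((x + 1) div m mod k) + (x + 1) mod m"
    by (metis mod_mult2_eq mult.commute)
  moreover have "y = m * a + c \<longleftrightarrow> y mod m = c \<and> y div m = a" if "c < m" for a c
    using that assms by auto
  ultimately show ?thesis using assms d r by (metis mod_less_divisor)
qed

text \<open>Here \<open>i\<close> and \<open>j\<close> are the sheets at the ends of an arc,
  \<open>p\<close> and \<open>p'\<close> the shifts there, and \<open>t\<close> is the carry at the
  wrap, which the shifts absorb.\<close>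

lemma add_right_mod_cancel_iff:
  fixes i j p p' t k :: nat
  assumes "i < k" "j < k" "[p' = p + t] (mod k)"
  shows "(j + p') mod k = ((i + p) mod k + t) mod k \<longleftrightarrow> i = j"
proof -
  have "(j + p') mod k = ((i + p) mod k + t) mod k \<longleftrightarrow> [j + p' = i + (p + t)] (mod k)"
    by (simp add: cong_def mod_add_left_eq add.assoc)
  also have "\<dots> \<longleftrightarrow> [j + (p + t) = i + (p + t)] (mod k)"
    using assms(3) by (meson cong_add cong_refl cong_sym cong_trans)
  also have "\<dots> \<longleftrightarrow> i = j"
    using assms(1,2) unfolding cong_add_rcancel_nat by (auto simp: cong_def)
  finally show ?thesis .
qed

lemma hom_count_cycle_copies_eq_cycle_graph:
  fixes F :: "'a pair_pre_digraph"
  assumes F: "simple_graph F" and m: "m > 0" and k: "k > 0"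
    and shift: "\<And>b. b \<in> pverts F \<rightarrow>\<^sub>E {..<m} \<Longrightarrow> \<exists>p. \<forall>x y. (x, y) \<in> parcs F \<longrightarrow>
      b y = (b x + 1) mod m \<longrightarrow> [p y = p x + (if b x + 1 = m then 1 else 0)] (mod k)"
  shows "hom_count F (cycle_copies k m) = hom_count F (cycle_graph (k * m))"
proof -
  let ?V = "pverts F"
  let ?A = "?V \<rightarrow>\<^sub>E {..<k * m}"
  have fin: "finite ?A" and sub: "parcs F \<subseteq> ?V \<times> ?V" and sy: "sym (parcs F)"
    using F by (auto simp: simple_graph_iff intro: finite_PiE)
  from shift obtain P where P: "\<And>b x y. b \<in> ?V \<rightarrow>\<^sub>E {..<m} \<Longrightarrow> (x, y) \<in> parcs F \<Longrightarrow>
      b y = (b x + 1) mod m \<Longrightarrow> [P b y = P b x + (if b x + 1 = m then 1 else 0)] (mod k)"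
    by metis
  define base where "base f = (\<lambda>x\<in>?V. f x mod m)" for f :: "'a \<Rightarrow> nat"
  \<comment> \<open>The shift depends on \<open>f\<close> only through \<open>base f\<close>, which
    \<open>T\<close> preserves. Undoing it modulo \<open>k\<close> recovers \<open>f\<close>, so
    \<open>T\<close> is injective on the finite set \<open>?A\<close>.\<close>
  define T where "T f = (\<lambda>x\<in>?V. m * ((f x div m + P (base f) x) mod k) + f x mod m)"
    for f :: "'a \<Rightarrow> nat"
  have base_in: "base f \<in> ?V \<rightarrow>\<^sub>E {..<m}" for f using m by (auto simp: base_def)
  have T_mod: "T f x mod m = f x mod m" and
    T_div: "T f x div m = (f x div m + P (base f) x) mod k" if "x \<in> ?V" for f x
    using that m by (auto simp: T_def)
  have base_T: "base (T f) = base f" for f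
    by (auto simp: base_def T_mod)
  have T_in: "T f \<in> ?A" for f
  proof -
    have "m * ((f x div m + P (base f) x) mod k) + f x mod m < k * m" for x
    proof -
      have "m * (Suc ((f x div m + P (base f) x) mod k)) \<le> m * k"
        using k by (intro mult_left_mono) (auto simp: Suc_le_eq)
      then show ?thesis using mod_less_divisor[OF m, of "f x"]
        by (simp add: mult.commute)
    qed
    then show ?thesis by (auto simp: T_def)
  qed
  have inj: "inj_on T ?A"
  proof (rule inj_onI)
    fix f g assume f: "f \<in> ?A" and g: "g \<in> ?A" and eq: "T f = T g"
    have bb: "base f = base g" using base_T[of f] base_T[of g] eq by simp
    show "f = g"
    proof (rule PiE_ext[OF f g])
      fix x assume x: "x \<in> ?V"
      have "f x div m < k" "g x div m < k"
        using f g x m by (auto simp: less_mult_imp_div_less PiE_iff)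
      moreover have "[f x div m + P (base g) x = g x div m + P (base g) x] (mod k)"
        using T_div[OF x, of f] T_div[OF x, of g] eq bb by (simp add: cong_def)
      then have "[f x div m = g x div m] (mod k)" unfolding cong_add_rcancel_nat .
      ultimately have "f x div m = g x div m" by (simp add: cong_def)
      moreover have "f x mod m = g x mod m"
        using T_mod[OF x, of f] T_mod[OF x, of g] eq by simp
      ultimately show "f x = g x" by (metis div_mult_mod_eq)
    qed
  qed
  have surj: "T ` ?A = ?A"
    using endo_inj_surj[OF fin _ inj] T_in by blast
  have step: "T f y = (T f x + 1) mod (k * m) \<longleftrightarrow>
      f x div m = f y div m \<and> f y mod m = (f x mod m + 1) mod m"
    if f: "f \<in> ?A" and xy: "(x, y) \<in> parcs F" for f x y
  proof -
    have x: "x \<in> ?V" and y: "y \<in> ?V" using xy sub by auto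
    have "f x div m < k" "f y div m < k"
      using f x y m by (auto simp: less_mult_imp_div_less PiE_iff)
    note c = add_right_mod_cancel_iff[OF this]
    show ?thesis
    proof (cases "f y mod m = (f x mod m + 1) mod m")
      case True
      then have "[P (base f) y = P (base f) x + (if f x mod m + 1 = m then 1 else 0)] (mod k)"
        using P[OF base_in xy, of f] x y by (simp add: base_def)
      from c[OF this] show ?thesis
        unfolding cyclic_successor_iff[OF m] T_mod[OF x] T_mod[OF y] T_div[OF x] T_div[OF y]
        using True by simp
    next
      case False
      then show ?thesis
        unfolding cyclic_successor_iff[OF m] T_mod[OF x] T_mod[OF y] by simp
    qed
  qed
  have arc: "(f x, f y) \<in> parcs (cycle_copies k m) \<longleftrightarrow>
      (T f x, T f y) \<in> parcs (cycle_graph (k * m))"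
    if f: "f \<in> ?A" and xy: "(x, y) \<in> parcs F" for f x y
  proof -
    have x: "x \<in> ?V" and y: "y \<in> ?V" using xy sub by auto
    \<comment> \<open>\<open>step\<close> handles one direction around the target cycle; the
      reversed arc handles the other.\<close>
    have yx: "(y, x) \<in> parcs F" using xy sy by (auto simp: sym_def)
    have "f x < k * m" "f y < k * m" "T f x < k * m" "T f y < k * m"
      using f T_in[of f] x y by (auto simp: PiE_iff)
    then show ?thesis
      using step[OF f xy] step[OF f yx] by (auto simp: cycle_copies_def cycle_graph_def)
  qed
  have "T ` graph_homs F (cycle_copies k m) = graph_homs F (cycle_graph (k * m))"
  proof -
    have 1: "graph_homs F (cycle_copies k m) =
      {f \<in> ?A. \<forall>u v. (u, v) \<in> parcs F \<longrightarrow> (f u, f v) \<in> parcs (cycle_copies k m)}"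
      by (simp add: graph_homs_def cycle_copies_def)
    have 2: "graph_homs F (cycle_graph (k * m)) =
      {f \<in> ?A. \<forall>u v. (u, v) \<in> parcs F \<longrightarrow> (f u, f v) \<in> parcs (cycle_graph (k * m))}"
      by (simp add: graph_homs_def cycle_graph_def)
    have "g \<in> T ` graph_homs F (cycle_copies k m)" if "g \<in> graph_homs F (cycle_graph (k * m))" for g
    proof -
      from that surj obtain f where "f \<in> ?A" "g = T f" unfolding 2 by blast
      with that arc show ?thesis unfolding 1 2 by blast
    qed
    moreover have "T f \<in> graph_homs F (cycle_graph (k * m))"
      if "f \<in> graph_homs F (cycle_copies k m)" for f
      using that arc T_in unfolding 1 2 by blast
    ultimately show ?thesis by blast
  qed
  moreover have "inj_on T (graph_homs F (cycle_copies k m))"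
    by (rule inj_on_subset[OF inj]) (auto simp: graph_homs_def cycle_copies_def)
  ultimately show ?thesis unfolding hom_count_def by (metis card_image)
qed

section \<open>Two constructions of shifts\<close>

lemma hom_count_cycle_copies_small:
  assumes F: "simple_graph F" and m: "card (pverts F) < m" and k: "k > 0"
  shows "hom_count F (cycle_copies k m) = hom_count F (cycle_graph (k * m))"
proof (rule hom_count_cycle_copies_eq_cycle_graph[OF F _ k])
  show "m > 0" using m by simp
  fix b assume b: "b \<in> pverts F \<rightarrow>\<^sub>E {..<m}"
  have fin: "finite (pverts F)" and sub: "parcs F \<subseteq> pverts F \<times> pverts F"
    using F by (auto simp: simple_graph_iff)
  have "card (b ` pverts F) < card {..<m}" using card_image_le[OF fin, of b] m by simp
  then have "\<not> {..<m} \<subseteq> b ` pverts F"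
    using card_mono[OF finite_imageI[OF fin], of "{..<m}" b] by linarith
  then obtain w where w: "w < m" "w \<notin> b ` pverts F" by auto
  \<comment> \<open>Cut at the missed vertex \<open>w\<close>: a step avoiding \<open>w\<close>
    changes \<open>p\<close> only at the wrap, from \<open>0\<close> above \<open>w\<close> to
    \<open>1\<close> below it.\<close>
  define p :: "'a \<Rightarrow> nat" where "p x = (if b x < w then 1 else 0)" for x
  have "[p y = p x + (if b x + 1 = m then 1 else 0)] (mod k)"
    if xy: "(x, y) \<in> parcs F" and e: "b y = (b x + 1) mod m" for x y
  proof -
    have x: "x \<in> pverts F" and y: "y \<in> pverts F" using xy sub by auto
    have "b x \<noteq> w" "b y \<noteq> w" using w x y by blast+
    moreover have "b x < m" using PiE_mem[OF b x] by simp
    ultimately have "p y = p x + (if b x + 1 = m then 1 else 0)"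
      using e w by (cases "b x + 1 = m") (auto simp: p_def)
    then show ?thesis by (simp only: cong_refl)
  qed
  then show "\<exists>p. \<forall>x y. (x, y) \<in> parcs F \<longrightarrow> b y = (b x + 1) mod m \<longrightarrow>
      [p y = p x + (if b x + 1 = m then 1 else 0)] (mod k)"
    by (intro exI[of _ p] allI impI)
qed

lemma hom_count_cycle_copies_bipartite:
  fixes c :: "'a \<Rightarrow> nat"
  assumes F: "simple_graph F" and m: "odd m"
    and c: "\<And>x y. (x, y) \<in> parcs F \<Longrightarrow> even (c x) \<noteq> even (c y)"
  shows "hom_count F (cycle_copies 2 m) = hom_count F (cycle_graph (2 * m))"
proof (rule hom_count_cycle_copies_eq_cycle_graph[OF F])
  show "m > 0" using m by (rule odd_pos)
  fix b assume b: "b \<in> pverts F \<rightarrow>\<^sub>E {..<m}"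
  have sub: "parcs F \<subseteq> pverts F \<times> pverts F" using F by (auto simp: simple_graph_iff)
  \<comment> \<open>An ordinary step flips the parities of both \<open>b\<close> and
    \<open>c\<close>; the wrap goes from the even \<open>m - 1\<close> to \<open>0\<close> and flips
    only that of \<open>c\<close>.\<close>
  have "[b y + c y = b x + c x + (if b x + 1 = m then 1 else 0)] (mod 2)"
    if xy: "(x, y) \<in> parcs F" and e: "b y = (b x + 1) mod m" for x y
  proof -
    have "x \<in> pverts F" using xy sub by auto
    with b have "b x < m" by (auto dest: PiE_mem)
    then have "b y = (if b x + 1 = m then 0 else b x + 1)" using e by simp
    then have "even (b y + c y) = even (b x + c x + (if b x + 1 = m then 1 else 0))"
      using m c[OF xy] by (simp split: if_splits) (metis even_Suc, blast)
    then show ?thesis unfolding cong_def by (simp only: mod_2_eq_odd)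
  qed
  then show "\<exists>p. \<forall>x y. (x, y) \<in> parcs F \<longrightarrow> b y = (b x + 1) mod m \<longrightarrow>
      [p y = p x + (if b x + 1 = m then 1 else 0)] (mod (2 :: nat))"
    by (intro exI[of _ "\<lambda>x. b x + c x"] allI impI)
qed simp

section \<open>Parity and the second query\<close>

lemma even_successor_mod:
  fixes x n :: nat
  assumes "even n" shows "even ((x + 1) mod n) \<longleftrightarrow> odd x"
  using assms by (simp add: dvd_mod_iff)

lemma parity_cycle_graph:
  assumes "(u, v) \<in> parcs (cycle_graph n)" "even n"
  shows "even u \<noteq> even v"
  using assms even_successor_mod[OF assms(2)] by (auto simp: cycle_graph_def)

lemma parity_cycle_copies:
  assumes "(u, v) \<in> parcs (cycle_copies k m)" "even m"
  shows "even u \<noteq> even v"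
proof -
  have "even (u mod m) \<noteq> even (v mod m)"
    using assms(1) even_successor_mod[OF assms(2), of "u mod m"]
      even_successor_mod[OF assms(2), of "v mod m"]
    by (auto simp: cycle_copies_def)
  then show ?thesis using assms(2) by (simp add: dvd_mod_iff)
qed

theorem theorem8p9:
  shows "\<not> (\<exists>F N X. adaptive_hom_algorithm 2 cycle_class F N X)"
proof
  assume "\<exists>F N X. adaptive_hom_algorithm 2 cycle_class F N X"
  then obtain F N X where "adaptive_hom_algorithm 2 cycle_class F N X" by blast
  then have F: "simple_graph F"
    and N: "\<And>ns. length ns = 1 \<Longrightarrow> simple_graph (N ns)"
    and X: "\<And>G. simple_graph G \<Longrightarrow>
      G \<in> cycle_class \<longleftrightarrow> [hom_count F G, hom_count (N [hom_count F G]) G] \<in> X"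
    by (simp_all add: adaptive_hom_algorithm_def numeral_2_eq_2 Let_def)
  \<comment> \<open>Oddness of \<open>q\<close> makes \<open>3 * q\<close> odd for the bipartite
    case, while \<open>2 * q\<close> is even; both exceed the number of vertices of
    \<open>F\<close>.\<close>
  define q where "q = 2 * card (pverts F) + 3"
  have q: "odd q" "q \<ge> 3" "card (pverts F) < q" by (auto simp: q_def)
  let ?C = "cycle_graph (6 * q)"
  define H where "H = N [hom_count F ?C]"
  have H: "simple_graph H" by (simp add: H_def N)
  have "simple_graph ?C" "?C \<in> cycle_class"
    using q by (auto intro: simple_graph_cycle_graph cycle_graph_in_cycle_class)
  with X have CX: "[hom_count F ?C, hom_count H ?C] \<in> X" by (simp add: H_def)
  \<comment> \<open>The first answers agree, so \<open>H\<close> is the second query for both graphs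
    and must separate them.\<close>
  have differ: "hom_count H (cycle_copies k m) \<noteq> hom_count H ?C"
    if km: "k * m = 6 * q" "k \<ge> 2" "m \<ge> q" for k m
  proof
    assume eq: "hom_count H (cycle_copies k m) = hom_count H ?C"
    have "hom_count F (cycle_copies k m) = hom_count F ?C"
      using hom_count_cycle_copies_small[OF F, of m k] km q by simp
    with eq CX have "cycle_copies k m \<in> cycle_class"
      using X[of "cycle_copies k m"] simple_graph_cycle_copies[of k m] km q
      by (simp add: H_def)
    then show False using cycle_copies_notin_cycle_class[of k m] km q by simp
  qed
  show False
  proof (cases "\<exists>c :: nat \<Rightarrow> nat. \<forall>x y. (x, y) \<in> parcs H \<longrightarrow> even (c x) \<noteq> even (c y)")
    case True
    then have "hom_count H (cycle_copies 2 (3 * q)) = hom_count H ?C"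
      using hom_count_cycle_copies_bipartite[OF H, of "3 * q"] q by auto
    then show False using differ[of 2 "3 * q"] by simp
  next
    case False
    \<comment> \<open>A homomorphism into \<open>G\<close> followed by parity would be a 2-colouring
      of \<open>H\<close>. Hence both counts below are zero.\<close>
    have "graph_homs H G = {}"
      if "\<And>u v. (u, v) \<in> parcs G \<Longrightarrow> even u \<noteq> even v" for G :: "nat pair_pre_digraph"
      using False that unfolding graph_homs_def by blast
    then have "graph_homs H ?C = {}" "graph_homs H (cycle_copies 3 (2 * q)) = {}"
      using parity_cycle_graph[of _ _ "6 * q"] parity_cycle_copies[of _ _ 3 "2 * q"] by simp_all
    then show False using differ[of 3 "2 * q"] by (simp add: hom_count_def)
  qed
qed

end
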